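(* When $p\in(1,\infty)$, the problem $$v^*=\min_{\boldsymbol x\in\mathcal X}\frac1N\sum_{i\in[N]}\min_{k\in[K]}\left\{{\boldsymbol\zeta^i}^\top\boldsymbol a_k(\boldsymbol x)+b_k(\boldsymbol x)-\theta\|\boldsymbol a_k(\boldsymbol x)\|_{p^*}\right\}$$ may not be MICP-R; that is, for every $p\in(1,\infty)$ there exist data $(n,m,K,N,\mathcal X,\theta,\{\boldsymbol\zeta^i\},\{\boldsymbol a_k\},\{b_k\})$ as in the context for which this problem is not MICP-R.
   Context: $[K]=\{1,\dots,K\}$. $\mathcal X\subseteq\mathbb R^n$ is a compact convex set with non-empty relative interior. For $k\in[K]$, $\boldsymbol a_k(\boldsymbol x)=\hat{\boldsymbol A}_k\boldsymbol x+\hat{\boldsymbol a}_k\in\mathbb R^m$ and $b_k(\boldsymbol x)=\hat{\boldsymbol B}_k^\top\boldsymbol x+\hat b_k\in\mathbb R$ are affine. $\boldsymbol\zeta^1,\dots,\boldsymbol\zeta^N\in\mathbb R^m$ are given sample points, $\theta\ge0$, and $\|\cdot\|_{p^*}$ is the dual norm of $\|\cdot\|_p$ ($1/p+1/p^*=1$). The problem is the distributionally favorable optimization problem over the type-$\infty$ Wasserstein ball of radius $\theta$ around the empirical distribution of $\{\boldsymbol\zeta^i\}$, with $Q(\boldsymbol x,\boldsymbol\xi)=\min_{k\in[K]}\{\boldsymbol\xi^\top\boldsymbol a_k(\boldsymbol x)+b_k(\boldsymbol x)\}$. MICP-R (mixed-integer convex programming representable): a set $S\subseteq\mathbb R^n$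 is MICP-R if there are integers $r,d$ and a closed convex set $M\subseteq\mathbb R^{n+r+d}$ such that $\boldsymbol x\in S$ if and only if there exist $\boldsymbol y\in\mathbb R^r$, $\boldsymbol z\in\mathbb Z^d$ with $(\boldsymbol x,\boldsymbol y,\boldsymbol z)\in M$. A function $f:S\to\mathbb R$ is MICP-R if both its domain $S$ and its epigraph $\{(\boldsymbol x,t):\boldsymbol x\in S,\ f(\boldsymbol x)\le t\}$ are MICP-R. A mathematical program is MICP-R if both its feasible region and its objective function (here, a function of $\boldsymbol x$ with domain $\mathcal X$) are MICP-R. *)

theory Defs
  imports "HOL-Analysis.Analysis" "HOL-Library.Function_Algebras"
begin

text \<open>
  The dimensions are existentially quantified, so \<open>\<real>\<^sup>n\<close> cannot be a type. As in
  \<^const>\<open>Euclidean_space\<close>, a vector is a function \<open>nat \<Rightarrow> real\<close> (coordinates counted from 0)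
  that vanishes from index \<open>n\<close> on. With the pointwise vector space structure below, \<^const>\<open>convex\<close>,
  \<^const>\<open>closed\<close>, \<^const>\<open>compact\<close> and \<^const>\<open>rel_interior\<close> apply to sets of such functions.
\<close>

instantiation "fun" :: (type, real_vector) real_vector
begin

definition scaleR_fun :: "real \<Rightarrow> ('a \<Rightarrow> 'b) \<Rightarrow> 'a \<Rightarrow> 'b"
  where "scaleR_fun c f = (\<lambda>x. c *\<^sub>R f x)"

instance
  by standard (simp_all add: scaleR_fun_def fun_eq_iff scaleR_add_right scaleR_add_left)

end

definition rvec :: "nat \<Rightarrow> (nat \<Rightarrow> real) set"
  where "rvec n = {x. \<forall>i\<ge>n. x i = 0}"

definition zvec :: "nat \<Rightarrow> (nat \<Rightarrow> real) set"
  where "zvec n = {x \<in> rvec n. \<forall>i<n. x i \<in> \<int>}"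

text \<open>
  The topology of \<open>nat \<Rightarrow> real\<close> is the product topology, and \<^term>\<open>rvec n\<close> is closed in it and
  carries the usual topology of \<open>\<real>\<^sup>n\<close>.
\<close>

lemma topspace_Euclidean_space_rvec: "topspace (Euclidean_space n) = rvec n"
  by (simp add: topspace_Euclidean_space rvec_def)

lemma Euclidean_space_eq_top_of_set: "Euclidean_space n = top_of_set (rvec n)"
  by (simp add: Euclidean_space_def rvec_def euclidean_product_topology)

lemma closed_rvec: "closed (rvec n)"
proof -
  have "rvec n = (\<Inter>i\<in>{n..}. {x. x i = 0})"
    by (auto simp: rvec_def)
  moreover have "closed {x :: nat \<Rightarrow> real. x i = 0}" for i
    by (intro closed_Collect_eq continuous_intros continuous_on_product_coordinates)
  ultimately show ?thesis
    by auto
qed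

lemma closedin_Euclidean_space_iff: "closedin (Euclidean_space n) M \<longleftrightarrow> closed M \<and> M \<subseteq> rvec n"
  by (metis Euclidean_space_eq_top_of_set closed_rvec closed_subset closedin_closed_eq)

lemma compactin_Euclidean_space_iff: "compactin (Euclidean_space n) X \<longleftrightarrow> compact X \<and> X \<subseteq> rvec n"
  by (auto simp: Euclidean_space_eq_top_of_set compactin_subtopology)

definition vec_append :: "nat \<Rightarrow> (nat \<Rightarrow> real) \<Rightarrow> (nat \<Rightarrow> real) \<Rightarrow> nat \<Rightarrow> real"
  where "vec_append n x y = (\<lambda>i. if i < n then x i else y (i - n))"

text \<open>The vector \<open>(x, t) \<in> \<real>\<^sup>n\<^sup>+\<^sup>1\<close>.\<close>

definition vec_snoc :: "nat \<Rightarrow> (nat \<Rightarrow> real) \<Rightarrow> real \<Rightarrow> nat \<Rightarrow> real"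
  where "vec_snoc n x t = vec_append n x (\<lambda>i. if i = 0 then t else 0)"

definition micp_r_set :: "nat \<Rightarrow> (nat \<Rightarrow> real) set \<Rightarrow> bool"
  where "micp_r_set n S \<longleftrightarrow> S \<subseteq> rvec n \<and>
    (\<exists>r d M. M \<subseteq> rvec (n + r + d) \<and> closed M \<and> convex M \<and>
      (\<forall>x\<in>rvec n. x \<in> S \<longleftrightarrow>
        (\<exists>y\<in>rvec r. \<exists>z\<in>zvec d. vec_append n x (vec_append r y z) \<in> M)))"

definition micp_r_fun :: "nat \<Rightarrow> (nat \<Rightarrow> real) set \<Rightarrow> ((nat \<Rightarrow> real) \<Rightarrow> real) \<Rightarrow> bool"
  where "micp_r_fun n S f \<longleftrightarrow> micp_r_set n S \<and>
    micp_r_set (n + 1) {vec_snoc n x t |x t. x \<in> S \<and> f x \<le> t}"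

text \<open>
  A program is given by its feasible region \<open>F\<close> and its objective function \<open>f\<close> with domain \<open>D\<close>.
\<close>

definition micp_r_program ::
    "nat \<Rightarrow> (nat \<Rightarrow> real) set \<Rightarrow> (nat \<Rightarrow> real) set \<Rightarrow> ((nat \<Rightarrow> real) \<Rightarrow> real) \<Rightarrow> bool"
  where "micp_r_program n F D f \<longleftrightarrow> micp_r_set n F \<and> micp_r_fun n D f"

definition dot :: "nat \<Rightarrow> (nat \<Rightarrow> real) \<Rightarrow> (nat \<Rightarrow> real) \<Rightarrow> real"
  where "dot n u v = (\<Sum>i<n. u i * v i)"

definition lp_norm :: "nat \<Rightarrow> real \<Rightarrow> (nat \<Rightarrow> real) \<Rightarrow> real"
  where "lp_norm n p v = (\<Sum>i<n. \<bar>v i\<bar> powr p) powr (1 / p)"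

text \<open>For conjugate exponents, \<^term>\<open>lp_norm n q\<close> is the dual norm of \<^term>\<open>lp_norm n p\<close>.\<close>

lemma lp_norm_dual:
  fixes p q :: real
  assumes p: "1 < p" and pq: "1 / p + 1 / q = 1"
  shows "lp_norm n q v = (SUP u\<in>{u \<in> rvec n. lp_norm n p u \<le> 1}. dot n u v)"
proof -
  have q: "1 < q"
  proof -
    have "0 < 1 / p" "1 / p < 1" using p by simp_all
    with pq have "0 < 1 / q" "1 / q < 1" by linarith+
    then show ?thesis by (simp add: divide_less_eq_1 zero_less_divide_iff)
  qed
  have qp: "(q - 1) * p = q"
    using p q pq by (simp add: field_simps)
  define s where "s = (\<Sum>i<n. \<bar>v i\<bar> powr q)"
  define t where "t = s powr (1 / q)"
  have t: "lp_norm n q v = t" by (simp add: lp_norm_def s_def t_def)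
  have s0: "s \<ge> 0" by (simp add: s_def sum_nonneg)
  have tq: "t powr q = s" using s0 q by (simp add: t_def powr_powr)
  have upper: "dot n u v \<le> t" if "lp_norm n p u \<le> 1" for u
  proof (cases "s = 0")
    case True
    then have "\<bar>v i\<bar> powr q = 0" if "i < n" for i
      using that by (simp add: s_def sum_nonneg_eq_0_iff)
    then show ?thesis by (simp add: dot_def True t_def)
  next
    case False
    with s0 have t0: "t > 0" by (simp add: t_def)
    let ?U = "\<Sum>i<n. \<bar>u i\<bar> powr p"
    have U: "?U \<le> 1"
    proof (rule ccontr)
      assume "\<not> ?U \<le> 1"
      then have "1 < ?U powr (1 / p)" using p by (intro gr_one_powr) auto
      with that show False by (simp add: lp_norm_def)
    qed
    have "dot n u v / t = (\<Sum>i<n. u i * v i / t)"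
      by (simp add: dot_def sum_divide_distrib)
    also have "\<dots> \<le> (\<Sum>i<n. \<bar>u i\<bar> powr p / p + (\<bar>v i\<bar> / t) powr q / q)"
    proof (rule sum_mono)
      fix i
      have "u i * v i / t \<le> \<bar>u i\<bar> * (\<bar>v i\<bar> / t)"
        using t0 by (simp add: divide_right_mono flip: abs_mult)
      also have "\<dots> \<le> \<bar>u i\<bar> powr p / p + (\<bar>v i\<bar> / t) powr q / q"
        using t0 p q pq by (intro Youngs_inequality) auto
      finally show "u i * v i / t \<le> \<bar>u i\<bar> powr p / p + (\<bar>v i\<bar> / t) powr q / q" .
    qed
    also have "\<dots> = ?U / p + s / s / q"
      using t0 by (simp add: sum.distrib powr_divide tq s_def flip: sum_divide_distrib)
    also have "\<dots> \<le> 1 / p + 1 / q"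
      using U p False by (simp add: divide_right_mono)
    finally show ?thesis using pq t0 by (simp add: field_simps)
  qed
  define w where "w = (\<lambda>i. if i < n then sgn (v i) * (\<bar>v i\<bar> / t) powr (q - 1) else 0)"
  have w: "w \<in> rvec n" by (simp add: w_def rvec_def)
  have attained: "lp_norm n p w \<le> 1 \<and> dot n w v = t"
  proof (cases "s = 0")
    case True
    then have "\<bar>v i\<bar> powr q = 0" if "i < n" for i
      using that by (simp add: s_def sum_nonneg_eq_0_iff)
    then show ?thesis by (simp add: dot_def True t_def lp_norm_def w_def)
  next
    case False
    with s0 have t0: "t > 0" by (simp add: t_def)
    have "(\<Sum>i<n. \<bar>w i\<bar> powr p) = (\<Sum>i<n. \<bar>v i\<bar> powr q / s)"
    proof (rule sum.cong[OF refl])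
      fix i assume "i \<in> {..<n}"
      then have "\<bar>w i\<bar> = (\<bar>v i\<bar> / t) powr (q - 1)"
        using t0 q by (cases "v i = 0") (simp_all add: w_def abs_mult abs_sgn_eq)
      then show "\<bar>w i\<bar> powr p = \<bar>v i\<bar> powr q / s"
        using t0 by (simp add: powr_powr qp powr_divide tq)
    qed
    also have "\<dots> = 1"
      using False by (simp add: s_def flip: sum_divide_distrib)
    finally have 1: "lp_norm n p w = 1" by (simp add: lp_norm_def)
    have "dot n w v = (\<Sum>i<n. t * (\<bar>v i\<bar> powr q / s))"
      unfolding dot_def
    proof (rule sum.cong[OF refl])
      fix i assume "i \<in> {..<n}"
      then have "w i * v i = t * ((\<bar>v i\<bar> / t) powr (q - 1) * (\<bar>v i\<bar> / t))"
        using t0 by (simp add: w_def mult_ac abs_sgn[of "v i"])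
      also have "(\<bar>v i\<bar> / t) powr (q - 1) * (\<bar>v i\<bar> / t) = (\<bar>v i\<bar> / t) powr q"
        using t0 by (cases "v i = 0") (simp_all add: powr_diff)
      finally show "w i * v i = t * (\<bar>v i\<bar> powr q / s)"
        using t0 by (simp add: powr_divide tq)
    qed
    also have "\<dots> = t"
      using False by (simp add: s_def flip: sum_divide_distrib sum_distrib_left)
    finally show ?thesis using 1 by simp
  qed
  have "(SUP u\<in>{u \<in> rvec n. lp_norm n p u \<le> 1}. dot n u v) = t"
    using w attained upper by (intro cSup_eq_maximum) (auto intro!: image_eqI[of _ _ w])
  with t show ?thesis by simp
qed

text \<open>Only the leading \<open>m \<times> n\<close> block of \<open>A\<close> is used.\<close>

definition affine_map ::
    "nat \<Rightarrow> nat \<Rightarrow> (nat \<Rightarrow> nat \<Rightarrow> real) \<Rightarrow> (nat \<Rightarrow> real) \<Rightarrow> (nat \<Rightarrow> real) \<Rightarrow> nat \<Rightarrow> real"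
  where "affine_map m n A a x = (\<lambda>j. if j < m then dot n (A j) x + a j else 0)"

end

theory Submission
  imports Defs
begin

text \<open>
  A set with an MICP representation cannot contain infinitely many points whose pairwise midpoints
  all lie outside the set: among infinitely many integer parts \<open>z\<close> two agree modulo 2, so their
  midpoint is integral again and convexity of \<open>M\<close> applies. For \<open>K = N = \<theta> = 1\<close>, \<open>a(x) = (x, 1)\<close>,
  \<open>X = [0, 1]\<close> and all other data zero, the objective is \<open>- (1 + x\<^sup>q)\<^sup>1\<^sup>/\<^sup>q\<close>, which is strictly
  concave, so the points of its graph violate this for the epigraph.
\<close>

lemma micp_r_set_midpoint:
  assumes S: "micp_r_set n S" and T: "infinite T" "T \<subseteq> S"
  obtains x y where "x \<in> T" "y \<in> T" "x \<noteq> y" "(1/2) *\<^sub>R x + (1/2) *\<^sub>R y \<in> S"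
proof -
  from S obtain r d M where Sn: "S \<subseteq> rvec n" and M: "convex M"
    and rep: "\<And>x. x \<in> rvec n \<Longrightarrow> x \<in> S \<longleftrightarrow>
        (\<exists>y\<in>rvec r. \<exists>z\<in>zvec d. vec_append n x (vec_append r y z) \<in> M)"
    unfolding micp_r_set_def by blast
  have "\<forall>x\<in>T. \<exists>y z. y \<in> rvec r \<and> z \<in> zvec d \<and> vec_append n x (vec_append r y z) \<in> M"
    using rep T Sn by blast
  then obtain Y Z where Y: "\<And>x. x \<in> T \<Longrightarrow> Y x \<in> rvec r" and Z: "\<And>x. x \<in> T \<Longrightarrow> Z x \<in> zvec d"
    and YZ: "\<And>x. x \<in> T \<Longrightarrow> vec_append n x (vec_append r (Y x) (Z x)) \<in> M"
    by metis
  \<comment> \<open>\<open>c x\<close> is the parity pattern of the integer part chosen for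
    \<open>x\<close>. There are only finitely many patterns, so two distinct points of
    \<open>T\<close> share one. Comparing points rather than integer parts also covers the case
    where many points of \<open>T\<close> have the same integer part.\<close>
  define c where "c x = {i. i < d \<and> odd \<lfloor>Z x i\<rfloor>}" for x
  have "c ` T \<subseteq> Pow {..<d}"
    by (auto simp: c_def)
  then have "\<not> inj_on c T"
    using T inj_on_finite by blast
  then obtain x y where xy: "x \<in> T" "y \<in> T" "x \<noteq> y" "c x = c y"
    unfolding inj_on_def by blast
  let ?mid = "\<lambda>u v :: nat \<Rightarrow> real. (1/2) *\<^sub>R u + (1/2) *\<^sub>R v"
  have "?mid (Z x) (Z y) i \<in> \<int>" if "i < d" for i
  proof -
    have "Z x i \<in> \<int>" "Z y i \<in> \<int>"
      using Z[OF xy(1)] Z[OF xy(2)] \<open>i < d\<close> by (auto simp: zvec_def)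
    then obtain k l where kl: "Z x i = of_int k" "Z y i = of_int l"
      by (elim Ints_cases)
    have "odd \<lfloor>Z x i\<rfloor> = odd \<lfloor>Z y i\<rfloor>"
      using xy(4) \<open>i < d\<close> by (auto simp: c_def)
    then have "even (k + l)"
      by (simp add: kl)
    then obtain h where "k + l = 2 * h"
      by blast
    then have "real_of_int k + real_of_int l = 2 * real_of_int h"
      by linarith
    then have "?mid (Z x) (Z y) i = of_int h"
      by (simp add: scaleR_fun_def kl)
    then show ?thesis
      by simp
  qed
  then have "?mid (Z x) (Z y) \<in> zvec d"
    using Z[OF xy(1)] Z[OF xy(2)] by (simp add: zvec_def rvec_def scaleR_fun_def)
  moreover have "?mid (Y x) (Y y) \<in> rvec r"
    using Y[OF xy(1)] Y[OF xy(2)] by (simp add: rvec_def scaleR_fun_def)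
  moreover have "vec_append n (?mid x y) (vec_append r (?mid (Y x) (Y y)) (?mid (Z x) (Z y)))
      = ?mid (vec_append n x (vec_append r (Y x) (Z x))) (vec_append n y (vec_append r (Y y) (Z y)))"
    by (auto simp: fun_eq_iff vec_append_def scaleR_fun_def)
  moreover have "\<dots> \<in> M"
    using convexD[OF M YZ[OF xy(1)] YZ[OF xy(2)], of "1/2" "1/2"] by simp
  moreover have "x \<in> rvec n" "y \<in> rvec n"
    using xy T Sn by auto
  then have "?mid x y \<in> rvec n"
    by (simp add: rvec_def scaleR_fun_def)
  ultimately have "?mid x y \<in> S"
    using rep by metis
  with xy that show thesis
    by blast
qed

text \<open>The mean value theorem on each half of the interval gives slopes \<open>g' c\<close> and
  \<open>g' e\<close> with \<open>c\<close> left of the midpoint and \<open>e\<close> right of it.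
  The halves have equal length, so a strictly increasing derivative makes \<open>g\<close> gain
  strictly more on the right half.\<close>

lemma strict_midpoint_convex:
  fixes g g' :: "real \<Rightarrow> real"
  assumes "x < y"
    and deriv: "\<And>t. \<lbrakk>x \<le> t; t \<le> y\<rbrakk> \<Longrightarrow> (g has_real_derivative g' t) (at t)"
    and mono: "\<And>s t. \<lbrakk>x \<le> s; s < t; t \<le> y\<rbrakk> \<Longrightarrow> g' s < g' t"
  shows "g ((x + y) / 2) < (g x + g y) / 2"
proof -
  let ?w = "(x + y) / 2"
  obtain c where c: "x < c" "c < ?w" "g ?w - g x = (?w - x) * g' c"
    using MVT2[of x ?w g g'] deriv \<open>x < y\<close> by force
  obtain e where e: "?w < e" "e < y" "g y - g ?w = (y - ?w) * g' e"
    using MVT2[of ?w y g g'] deriv \<open>x < y\<close> by force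
  have "(y - ?w) * g' c < (y - ?w) * g' e"
    using mono[of c e] c(1,2) e(1,2) by (intro mult_strict_left_mono) auto
  moreover have "?w - x = y - ?w"
    by (simp add: field_simps)
  ultimately have "g ?w - g x < g y - g ?w"
    using c(3) e(3) by metis
  moreover have "u < (v + w) / 2" if "u - v < w - u" for u v w :: real
    using that by simp
  ultimately show ?thesis
    by blast
qed

text \<open>The derivative is a positive power of u / (1 + u) with u = \<open>t powr q\<close>, and
  is therefore strictly increasing in \<open>t\<close>. Taking \<open>x\<close> positive keeps every
  \<open>t\<close> in the range where the differentiation rule for \<open>powr\<close>
  applies.\<close>

lemma powr_norm_strict_midpoint_convex:
  fixes q x y :: real
  assumes q: "1 < q" and x: "0 < x" and xy: "x < y"
  shows "(1 + ((x + y) / 2) powr q) powr (1 / q)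
    < ((1 + x powr q) powr (1 / q) + (1 + y powr q) powr (1 / q)) / 2"
proof (rule strict_midpoint_convex[where g = "\<lambda>t. (1 + t powr q) powr (1 / q)"
      and g' = "\<lambda>t. (t powr q / (1 + t powr q)) powr ((q - 1) / q)", OF xy])
  fix t assume "x \<le> t" "t \<le> y"
  then have t: "0 < t" using x by simp
  then have pos: "0 < 1 + t powr q" by (simp add: add_pos_nonneg)
  \<comment> \<open>The quotient form shows monotonicity; the chain rule yields a product instead.
    This computation identifies the two.\<close>
  have "(t powr q / (1 + t powr q)) powr ((q - 1) / q)
      = (t powr q) powr ((q - 1) / q) * (1 + t powr q) powr (- ((q - 1) / q))"
    using t pos by (simp add: powr_divide powr_minus_divide)
  also have "(t powr q) powr ((q - 1) / q) = t powr (q - 1)"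
    using q by (simp add: powr_powr)
  also have "- ((q - 1) / q) = 1 / q - 1"
    using q by (simp add: field_simps)
  finally have eq: "(t powr q / (1 + t powr q)) powr ((q - 1) / q)
      = (1 / q) * (1 + t powr q) powr (1 / q - 1) * (q * t powr (q - 1))"
    using q by simp
  show "((\<lambda>t. (1 + t powr q) powr (1 / q)) has_real_derivative
      (t powr q / (1 + t powr q)) powr ((q - 1) / q)) (at t)"
    unfolding eq using t pos q by (auto intro!: derivative_eq_intros)
next
  fix s t assume "x \<le> s" "s < t" "t \<le> y"
  then have s: "0 < s" and st: "s powr q < t powr q"
    using x q by (auto intro: powr_less_mono2)
  then have "s powr q / (1 + s powr q) < t powr q / (1 + t powr q)"
    by (simp add: divide_simps add_pos_nonneg algebra_simps)
  then show "(s powr q / (1 + s powr q)) powr ((q - 1) / q)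
      < (t powr q / (1 + t powr q)) powr ((q - 1) / q)"
    using q by (intro powr_less_mono2) auto
qed

theorem corollary3:
  fixes p q :: real
  assumes "1 < p" and "1 / p + 1 / q = 1"
  shows "\<exists>(n :: nat) (m :: nat) (K :: nat) (N :: nat) (X :: (nat \<Rightarrow> real) set) (\<theta> :: real)
      (\<zeta> :: nat \<Rightarrow> nat \<Rightarrow> real)
      (A :: nat \<Rightarrow> nat \<Rightarrow> nat \<Rightarrow> real) (a :: nat \<Rightarrow> nat \<Rightarrow> real)
      (B :: nat \<Rightarrow> nat \<Rightarrow> real) (b :: nat \<Rightarrow> real).
      1 \<le> n \<and> 1 \<le> m \<and> 1 \<le> K \<and> 1 \<le> N \<and>
      X \<subseteq> rvec n \<and> compact X \<and> convex X \<and> rel_interior X \<noteq> {} \<and>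
      0 \<le> \<theta> \<and>
      (\<forall>i\<in>{1..N}. \<zeta> i \<in> rvec m) \<and>
      (\<forall>k\<in>{1..K}. a k \<in> rvec m \<and> B k \<in> rvec n) \<and>
      \<not> micp_r_program n X X
          (\<lambda>x. 1 / real N * (\<Sum>i=1..N. MIN k\<in>{1..K}.
             dot m (\<zeta> i) (affine_map m n (A k) (a k) x) + (dot n (B k) x + b k)
             - \<theta> * lp_norm m q (affine_map m n (A k) (a k) x)))"
proof -
  have q: "1 < q"
  proof -
    have "0 < 1 / p" "1 / p < 1" using \<open>1 < p\<close> by simp_all
    with assms(2) have "0 < 1 / q" "1 / q < 1" by linarith+
    then show ?thesis by (simp add: divide_less_eq_1 zero_less_divide_iff)
  qed
  define e :: "real \<Rightarrow> nat \<Rightarrow> real" where "e t = (\<lambda>i. if i = 0 then t else 0)" for t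
  define X where "X = e ` {0..1}"
  \<comment> \<open>The l_q norm is linear along rays from the origin, so strict convexity needs an
    image line that misses the origin. The constant second coordinate supplied by \<open>a\<close>
    ensures this, which is why \<open>m\<close> is 2.\<close>
  define A :: "nat \<Rightarrow> nat \<Rightarrow> nat \<Rightarrow> real" where "A = (\<lambda>k j i. if j = 0 then 1 else 0)"
  define a :: "nat \<Rightarrow> nat \<Rightarrow> real" where "a = (\<lambda>k j. if j = 1 then 1 else 0)"
  define g where "g t = (1 + t powr q) powr (1 / q)" for t :: real
  define f where "f = (\<lambda>x. 1 / real 1 * (\<Sum>i=(1::nat)..1. MIN k\<in>{1..1}.
      dot 2 ((\<lambda>i j. 0) i) (affine_map 2 1 (A k) (a k) x) + (dot 1 ((\<lambda>k j. 0) k) x + (\<lambda>k. 0) k)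
      - 1 * lp_norm 2 q (affine_map 2 1 (A k) (a k) x)))"
  have f: "f (e t) = - g t" if "0 \<le> t" for t
    using that by (simp add: f_def dot_def affine_map_def lp_norm_def A_def a_def e_def g_def
        numeral_2_eq_2 add.commute)
  have X_rvec: "X \<subseteq> rvec 1"
    by (auto simp: X_def e_def rvec_def)
  have "continuous_on {0..1} e"
  proof (rule continuous_on_coordinatewise_then_product)
    show "continuous_on {0..1} (\<lambda>t. e t i)" for i
      by (cases "i = 0") (auto simp: e_def intro: continuous_intros)
  qed
  then have compact: "compact X"
    unfolding X_def by (intro compact_continuous_image) auto
  have e_comb: "u *\<^sub>R e s + v *\<^sub>R e t = e (u * s + v * t)" for u v s t
    by (auto simp: fun_eq_iff e_def scaleR_fun_def)
  have convex: "convex X"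
  proof (rule convexI)
    fix x y :: "nat \<Rightarrow> real" and c d :: real
    assume "x \<in> X" "y \<in> X" and cd: "0 \<le> c" "0 \<le> d" "c + d = 1"
    then obtain s t where "x = e s" "s \<in> {0..1}" "y = e t" "t \<in> {0..1}"
      by (auto simp: X_def)
    moreover from this have "c * s + d * t \<in> {0..1}"
      using convexD[of "{0..1::real}" s t c d] cd by simp
    ultimately show "c *\<^sub>R x + d *\<^sub>R y \<in> X"
      by (auto simp: X_def e_comb)
  qed
  have "rel_interior X \<noteq> {}"
  proof -
    have "affine (rvec 1)"
      by (simp add: affine_def rvec_def scaleR_fun_def)
    with X_rvec have hull: "affine hull X \<subseteq> rvec 1"
      by (rule hull_minimal)
    \<comment> \<open>The affine hull stays inside \<open>rvec 1\<close>, where coordinate 0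
      determines the vector. Cutting it with the open strip therefore leaves a relatively open
      subset of \<open>X\<close>, and \<open>e (1/2)\<close> lies in it.\<close>
    let ?T = "affine hull X \<inter> {x. 0 < x 0 \<and> x 0 < 1}"
    have "open {x :: nat \<Rightarrow> real. 0 < x 0 \<and> x 0 < 1}"
      by (intro open_Collect_conj open_Collect_less continuous_intros
          continuous_on_product_coordinates)
    then have "openin (top_of_set (affine hull X)) ?T"
      by (rule openin_open_Int)
    moreover have "?T \<subseteq> X"
    proof
      fix x assume x: "x \<in> ?T"
      then have "x = e (x 0)"
        using hull by (auto simp: fun_eq_iff e_def rvec_def)
      with x show "x \<in> X"
        unfolding X_def by (intro image_eqI[of _ _ "x 0"]) auto
    qed
    moreover have "e (1/2) \<in> ?T"
      by (auto simp: X_def e_def intro: hull_inc)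
    ultimately show ?thesis
      unfolding rel_interior_def by blast
  qed
  moreover have "\<not> micp_r_program 1 X X f"
  proof
    assume "micp_r_program 1 X X f"
    then have epi: "micp_r_set (1 + 1) {vec_snoc 1 x t |x t. x \<in> X \<and> f x \<le> t}" (is "micp_r_set _ ?E")
      by (simp add: micp_r_program_def micp_r_fun_def)
    define P where "P s = vec_snoc 1 (e s) (- g s)" for s
    have P_nth: "P s 0 = s" "P s 1 = - g s" for s
      by (simp_all add: P_def vec_snoc_def vec_append_def e_def)
    \<comment> \<open>The parameter 0 is left out because the strict midpoint inequality is
      available only for positive arguments; infinitely many graph points remain.\<close>
    have "inj_on P {0<..1}"
      by (rule inj_onI) (metis P_nth(1))
    then have "infinite (P ` {0<..1})"
      by (simp add: finite_image_iff infinite_Ioc)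
    moreover have "P ` {0<..1} \<subseteq> ?E"
      by (fastforce simp: P_def X_def f)
    ultimately obtain u v where uv: "u \<in> P ` {0<..1}" "v \<in> P ` {0<..1}" "u \<noteq> v"
      "(1/2) *\<^sub>R u + (1/2) *\<^sub>R v \<in> ?E"
      by (rule micp_r_set_midpoint[OF epi])
    then obtain s t where st: "s \<in> {0<..1}" "t \<in> {0<..1}" "P s \<noteq> P t"
      and mid: "(1/2) *\<^sub>R P s + (1/2) *\<^sub>R P t \<in> ?E"
      by fast
    from mid obtain w h where wh: "(1/2) *\<^sub>R P s + (1/2) *\<^sub>R P t = vec_snoc 1 (e w) h"
      "0 \<le> w" "f (e w) \<le> h"
      by (auto simp: X_def)
    \<comment> \<open>Coordinate 0 of the midpoint is the argument, coordinate 1 the epigraph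
      height. Since \<open>f (e w)\<close> is \<open>- g w\<close>, the epigraph inequality turns
      into midpoint concavity of \<open>g\<close> at \<open>s\<close> and \<open>t\<close>.\<close>
    have "w = (s + t) / 2" "h = - (g s + g t) / 2"
      using fun_cong[OF wh(1), of 0] fun_cong[OF wh(1), of 1]
      by (simp_all add: scaleR_fun_def P_nth vec_snoc_def vec_append_def e_def P_nth(2)[simplified])
    with wh f have "(g s + g t) / 2 \<le> g ((s + t) / 2)"
      by simp
    moreover have "s \<noteq> t"
      using st by auto
    ultimately show False
      using powr_norm_strict_midpoint_convex[OF q, of s t]
        powr_norm_strict_midpoint_convex[OF q, of t s] st
      by (cases "s < t") (auto simp: g_def add.commute)
  qed
  ultimately show ?thesis
    using X_rvec compact convex unfolding f_def
    by (intro exI[of _ "1::nat"] exI[of _ "2::nat"] exI[of _ X] exI[of _ "1::real"]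
        exI[of _ "\<lambda>i j. 0 :: real"] exI[of _ A] exI[of _ a] exI[of _ "\<lambda>k. 0 :: real"] conjI)
      (auto simp: rvec_def a_def)
qed

end
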